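(* Let $R$ be a commutative ring with nonzero identity and with Jacobson radical $M$. The following statements are equivalent. (1) Every proper ideal of $R$ is an $OA$-ideal. (2) Every proper principal ideal of $R$ is an $OA$-ideal. (3) $R$ is local and $M^2=\{0\}$.
   Context: All rings are commutative with nonzero identity. Local means having exactly one maximal ideal (no Noetherian assumption). An ideal $I$ of $R$ is proper if $I\neq R$. A proper ideal $I$ of $R$ is an $OA$-ideal ($1$-absorbing prime ideal) if whenever $a,b,c\in R$ are nonunits with $abc\in I$, then $ab\in I$ or $c\in I$. *)

theory Defs
  imports "HOL-Algebra.Ideal_Product"
begin

text \<open>A 1-absorbing prime ideal. The nonunits of \<open>R\<close> are the elements of \<open>carrier R - Units R\<close>;
  in particular \<open>\<zero>\<close> is one of them when \<open>R\<close> is not the zero ring.\<close>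

locale oa_ideal = ideal I R + cring R for I and R (structure) +
  assumes I_notcarr: "carrier R \<noteq> I"
    and I_oa: "\<lbrakk>a \<in> carrier R - Units R; b \<in> carrier R - Units R; c \<in> carrier R - Units R;
                a \<otimes> b \<otimes> c \<in> I\<rbrakk> \<Longrightarrow> a \<otimes> b \<in> I \<or> c \<in> I"

text \<open>The intersection of all maximal ideals, taken inside the carrier, so that it would be
  \<open>carrier R\<close> for a ring without maximal ideals.\<close>

definition jacobson_radical :: "('a, 'b) ring_scheme \<Rightarrow> 'a set"
  where "jacobson_radical R = carrier R \<inter> \<Inter>{I. maximalideal I R}"

text \<open>No Noetherian assumption is made.\<close>

locale local_ring = cring R for R (structure) +
  assumes unique_maximalideal: "\<exists>!I. maximalideal I R"

end

theory Submission
  imports Defs "HOL-Algebra.Divisibility"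
begin

text \<open>If two nonunits have a unit sum, every OA-ideal is prime on nonunits; applied to the ideals
  generated by \<open>x \<otimes> x\<close> and by \<open>\<zero>\<close>, this makes each nonunit \<open>x\<close> vanish. So under the condition on
  principal ideals the nonunits are closed under addition and form the unique maximal ideal. There,
  for nonunits \<open>a\<close>, \<open>b\<close>, the ideal generated by \<open>a \<otimes> b \<otimes> a\<close> contains \<open>a \<otimes> b\<close> or \<open>a\<close>, and in
  either case \<open>a \<otimes> b\<close> is a multiple of itself by a nonunit, hence zero. Conversely, if \<open>M\<close> is the
  unique maximal ideal and \<open>M\<close> squares to zero, then every nonunit lies in \<open>M\<close> because \<open>\<one> \<ominus> m\<close> has
  the inverse \<open>\<one> \<oplus> m\<close>, so every product of two nonunits is zero.\<close>

context cring
begin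

lemma nonunit_mult:
  assumes "a \<in> carrier R - Units R" "b \<in> carrier R"
  shows "a \<otimes> b \<in> carrier R - Units R"
  using assms unit_factor by blast

lemma mult_Units_eq_zero:
  assumes "x \<in> carrier R" "u \<in> Units R" "x \<otimes> u = \<zero>"
  shows "x = \<zero>"
proof -
  have "x = x \<otimes> u \<otimes> inv u" using assms(1,2) by (simp add: m_assoc Units_closed)
  also have "\<dots> = \<zero>" using assms(2,3) by simp
  finally show ?thesis .
qed

lemma ideal_proper_iff_nonunits:
  assumes "ideal I R"
  shows "I \<noteq> carrier R \<longleftrightarrow> I \<subseteq> carrier R - Units R"
proof
  interpret ideal I R by fact
  assume "I \<noteq> carrier R"
  show "I \<subseteq> carrier R - Units R"
  proof
    fix u assume u: "u \<in> I"
    have "I = carrier R" if "u \<in> Units R"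
      using I_l_closed[OF u, of "inv u"] that one_imp_carrier by simp
    with \<open>I \<noteq> carrier R\<close> u show "u \<in> carrier R - Units R" by (auto intro: Icarr)
  qed
qed auto

lemma cgenideal_proper:
  assumes "a \<in> carrier R - Units R"
  shows "PIdl a \<noteq> carrier R"
proof -
  have "PIdl a \<subseteq> carrier R - Units R"
    using assms nonunit_mult[OF assms] by (auto simp: cgenideal_def m_comm)
  then show ?thesis by blast
qed

lemma oa_ideal_cgenideal:
  assumes "\<And>I. principalideal I R \<Longrightarrow> I \<noteq> carrier R \<Longrightarrow> oa_ideal I R"
    and "a \<in> carrier R - Units R"
  shows "oa_ideal (PIdl a) R"
  using assms cgenideal_is_principalideal cgenideal_proper by simp

text \<open>If \<open>b\<close> is outside \<open>I\<close>, the OA property applied to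
  \<open>c\<close>, \<open>a\<close>, \<open>b\<close> puts \<open>c \<otimes> a\<close> into
  \<open>I\<close> for every nonunit \<open>c\<close>. Adding the cases \<open>c = x\<close> and
  \<open>c = y\<close> leaves a unit multiple of \<open>a\<close> in \<open>I\<close>.\<close>

lemma oa_ideal_prime_if_unit_sum:
  assumes "oa_ideal I R"
    and x: "x \<in> carrier R - Units R" and y: "y \<in> carrier R - Units R" and xy: "x \<oplus> y \<in> Units R"
    and a: "a \<in> carrier R - Units R" and b: "b \<in> carrier R - Units R" and ab: "a \<otimes> b \<in> I"
  shows "a \<in> I \<or> b \<in> I"
proof (rule disjCI)
  interpret oa_ideal I R by fact
  assume "b \<notin> I"
  have mem: "c \<otimes> a \<in> I" if c: "c \<in> carrier R - Units R" for c
  proof -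
    have "c \<otimes> a \<otimes> b \<in> I" using I_l_closed[OF ab, of c] a b c by (simp add: m_assoc)
    then show ?thesis using I_oa[OF c a b] \<open>b \<notin> I\<close> by simp
  qed
  have "(x \<oplus> y) \<otimes> a \<in> I"
    using a_closed[OF mem[OF x] mem[OF y]] x y a by (simp add: l_distr)
  from I_l_closed[OF this Units_inv_closed[OF xy]]
  have "inv (x \<oplus> y) \<otimes> ((x \<oplus> y) \<otimes> a) \<in> I" .
  also have "inv (x \<oplus> y) \<otimes> ((x \<oplus> y) \<otimes> a) = a"
    using a x y xy by (simp add: m_assoc[symmetric])
  finally show "a \<in> I" .
qed

lemma nonunits_add_closed:
  assumes oa: "\<And>I. principalideal I R \<Longrightarrow> I \<noteq> carrier R \<Longrightarrow> oa_ideal I R"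
    and ne: "\<one> \<noteq> \<zero>"
    and x: "x \<in> carrier R - Units R" and y: "y \<in> carrier R - Units R"
  shows "x \<oplus> y \<in> carrier R - Units R"
proof (rule ccontr)
  assume "\<not> ?thesis"
  then have xy: "x \<oplus> y \<in> Units R" using x y by simp
  have zero: "\<zero> \<in> carrier R - Units R"
    using ne by (auto dest: Units_r_inv_ex)
  have "x \<in> PIdl (x \<otimes> x)"
    using oa_ideal_prime_if_unit_sum[OF oa_ideal_cgenideal[OF oa] x y xy x x] x
      cgenideal_self[of "x \<otimes> x"] nonunit_mult[OF x] by blast
  then obtain r where r: "r \<in> carrier R" "x = r \<otimes> (x \<otimes> x)"
    unfolding cgenideal_def by blast
  \<comment> \<open>The relation \<open>x = r \<otimes> (x \<otimes> x)\<close> becomes a vanishing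
    product, to which primeness of the zero ideal on nonunits can be applied.\<close>
  have "x \<otimes> (\<one> \<ominus> x \<otimes> r) = x \<ominus> r \<otimes> (x \<otimes> x)"
    using x r(1) by (simp add: minus_eq r_distr r_minus m_ac)
  then have xr: "x \<otimes> (\<one> \<ominus> x \<otimes> r) = \<zero>"
    using x r(2)[symmetric] by (simp add: minus_eq r_neg)
  have zero_ideal: "PIdl \<zero> = {\<zero>}" by (auto simp: cgenideal_def intro!: exI[of _ \<zero>])
  have "x = \<zero>"
  proof (cases "\<one> \<ominus> x \<otimes> r \<in> Units R")
    case True
    then show ?thesis using mult_Units_eq_zero xr x by blast
  next
    case False
    then have "\<one> \<ominus> x \<otimes> r \<in> carrier R - Units R" using x r(1) by simp
    then have "x \<in> PIdl \<zero> \<or> \<one> \<ominus> x \<otimes> r \<in> PIdl \<zero>"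
      using oa_ideal_prime_if_unit_sum[OF oa_ideal_cgenideal[OF oa zero] x y xy x] xr zero_ideal
      by simp
    \<comment> \<open>Otherwise \<open>r\<close> would be an inverse of the nonunit
      \<open>x\<close>.\<close>
    moreover have "\<one> \<ominus> x \<otimes> r \<noteq> \<zero>"
    proof
      assume "\<one> \<ominus> x \<otimes> r = \<zero>"
      moreover have "\<one> = (\<one> \<ominus> x \<otimes> r) \<oplus> x \<otimes> r"
        using x r(1) by (simp add: minus_eq a_assoc l_neg)
      ultimately have "\<one> = x \<otimes> r" using x r(1) by (metis DiffD1 l_zero m_closed)
      then show False using nonunit_mult[OF x r(1)] Units_one_closed by simp
    qed
    ultimately show ?thesis using zero_ideal by simp
  qed
  then show False using xy y by simp
qed

text \<open>Every proper ideal consists of nonunits, so once the nonunits form an ideal it is the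
  largest proper one.\<close>

lemma maximalideal_iff_nonunits:
  assumes ne: "\<one> \<noteq> \<zero>"
    and add: "\<And>x y. x \<in> carrier R - Units R \<Longrightarrow> y \<in> carrier R - Units R \<Longrightarrow>
      x \<oplus> y \<in> carrier R - Units R"
  shows "maximalideal I R \<longleftrightarrow> I = carrier R - Units R"
proof -
  have "subgroup (carrier R - Units R) (add_monoid R)"
  proof (rule add.subgroupI)
    have "\<zero> \<in> carrier R - Units R"
      using ne by (auto dest: Units_r_inv_ex)
    then show "carrier R - Units R \<noteq> {}" by blast
    show "\<ominus> a \<in> carrier R - Units R" if "a \<in> carrier R - Units R" for a
      using nonunit_mult[OF that, of "\<ominus> \<one>"] that by (simp add: r_minus)
  qed (use add in auto)
  then have ideal: "ideal (carrier R - Units R) R"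
    using nonunit_mult by (intro idealI[OF ring_axioms]) (auto simp: m_comm)
  have ne_carr: "carrier R \<noteq> carrier R - Units R"
    using Units_one_closed one_closed by blast
  have "maximalideal (carrier R - Units R) R"
    using ideal_proper_iff_nonunits ne_carr
    by (intro maximalidealI[OF ideal]) blast+
  moreover have "I = carrier R - Units R" if I: "maximalideal I R"
    using maximalideal.I_maximal[OF I ideal] ideal_proper_iff_nonunits
      maximalideal.I_notcarr[OF I] maximalideal.axioms(1)[OF I] ne_carr by blast
  ultimately show ?thesis by blast
qed

lemma nonunits_mult_eq_zero:
  assumes oa: "\<And>I. principalideal I R \<Longrightarrow> I \<noteq> carrier R \<Longrightarrow> oa_ideal I R"
    and ne: "\<one> \<noteq> \<zero>"
    and a: "a \<in> carrier R - Units R" and b: "b \<in> carrier R - Units R"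
  shows "a \<otimes> b = \<zero>"
proof -
  \<comment> \<open>Repeating \<open>a\<close> as the third factor makes both OA alternatives
    useful: each expresses \<open>a \<otimes> b\<close> as itself times a multiple of
    \<open>a\<close>.\<close>
  have aba: "a \<otimes> b \<otimes> a \<in> carrier R - Units R"
    using nonunit_mult a b by simp
  have "a \<otimes> b \<otimes> a \<in> PIdl (a \<otimes> b \<otimes> a)"
    using aba by (simp add: cgenideal_self)
  then consider "a \<otimes> b \<in> PIdl (a \<otimes> b \<otimes> a)" | "a \<in> PIdl (a \<otimes> b \<otimes> a)"
    using oa_ideal.I_oa[OF oa_ideal_cgenideal[OF oa aba] a b a] by blast
  then have "\<exists>c \<in> carrier R - Units R. a \<otimes> b = a \<otimes> b \<otimes> c"
  proof cases
    case 1
    then obtain r where r: "r \<in> carrier R" "a \<otimes> b = r \<otimes> (a \<otimes> b \<otimes> a)"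
      unfolding cgenideal_def by blast
    note r(2)
    also have "r \<otimes> (a \<otimes> b \<otimes> a) = a \<otimes> b \<otimes> (a \<otimes> r)" using a b r(1) by (simp add: m_ac)
    finally show ?thesis using nonunit_mult[OF a r(1)] by blast
  next
    case 2
    then obtain r where r: "r \<in> carrier R" "a = r \<otimes> (a \<otimes> b \<otimes> a)"
      unfolding cgenideal_def by blast
    have "a \<otimes> b = (r \<otimes> (a \<otimes> b \<otimes> a)) \<otimes> b"
      using arg_cong[OF r(2), of "\<lambda>x. x \<otimes> b"] .
    also have "\<dots> = a \<otimes> b \<otimes> (a \<otimes> (b \<otimes> r))" using a b r(1) by (simp add: m_ac)
    finally show ?thesis using nonunit_mult[OF a, of "b \<otimes> r"] b r(1) by blast
  qed
  then obtain c where c: "c \<in> carrier R - Units R" and abc: "a \<otimes> b = a \<otimes> b \<otimes> c" by blast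
  \<comment> \<open>Two nonunits cannot sum to \<open>\<one>\<close>. The unit
    \<open>\<one> \<ominus> c\<close> annihilates \<open>a \<otimes> b\<close>.\<close>
  have "\<one> \<ominus> c \<in> Units R"
  proof (rule ccontr)
    assume "\<one> \<ominus> c \<notin> Units R"
    then have "(\<one> \<ominus> c) \<oplus> c \<in> carrier R - Units R"
      using c by (intro nonunits_add_closed[OF oa ne]) simp_all
    moreover have "(\<one> \<ominus> c) \<oplus> c = \<one>" using c by (simp add: minus_eq a_assoc l_neg)
    ultimately show False by simp
  qed
  moreover have "a \<otimes> b \<otimes> (\<one> \<ominus> c) = \<zero>"
    using a b c abc[symmetric] by (simp add: minus_eq r_distr r_minus r_neg)
  ultimately show ?thesis
    using a b mult_Units_eq_zero by simp
qed

end

lemma (in local_ring) maximalideal_jacobson_radical: "maximalideal (jacobson_radical R) R"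
proof -
  obtain N where N: "maximalideal N R" and uniq: "\<And>I. maximalideal I R \<Longrightarrow> I = N"
    using unique_maximalideal by blast
  have "{I. maximalideal I R} = {N}" using N uniq by blast
  moreover have "N \<subseteq> carrier R"
    using N by (auto dest: maximalideal.axioms(1) ideal.Icarr)
  ultimately have "jacobson_radical R = N"
    by (auto simp: jacobson_radical_def)
  with N show ?thesis by simp
qed

text \<open>The vanishing of the square of \<open>M\<close> replaces the appeal to Zorn's lemma that is needed to
  place a nonunit in a maximal ideal of an arbitrary ring.\<close>

lemma (in cring) nonunits_subset_maximalideal:
  assumes "maximalideal M R" and sq: "M \<cdot> M = {\<zero>}"
  shows "carrier R - Units R \<subseteq> M"
proof
  interpret maximalideal M R by fact
  fix a assume a: "a \<in> carrier R - Units R"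
  show "a \<in> M"
  proof (rule ccontr)
    assume "a \<notin> M"
    have Pa: "ideal (PIdl a) R" using a by (simp add: cgenideal_ideal)
    \<comment> \<open>By maximality, enlarging \<open>M\<close> by \<open>a\<close> gives the whole
      ring, hence \<open>\<one>\<close> is an element of \<open>M\<close> plus a multiple of
      \<open>a\<close>.\<close>
    have sum: "ideal (M <+>\<^bsub>R\<^esub> PIdl a) R" by (rule add_ideals[OF is_ideal Pa])
    have add_mem: "m \<oplus> p \<in> M <+>\<^bsub>R\<^esub> PIdl a" if "m \<in> M" "p \<in> PIdl a" for m p
      using that unfolding set_add_def' by blast
    have "m \<in> M <+>\<^bsub>R\<^esub> PIdl a" if "m \<in> M" for m
      using add_mem[OF that, of \<zero>] Icarr[OF that] Pa
      by (simp add: additive_subgroup.zero_closed ideal.axioms(1))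
    moreover have "a \<in> M <+>\<^bsub>R\<^esub> PIdl a"
      using add_mem[of \<zero> a] a by (simp add: cgenideal_self)
    ultimately have "M <+>\<^bsub>R\<^esub> PIdl a = carrier R"
      using I_maximal[OF sum] \<open>a \<notin> M\<close> ideal.Icarr[OF sum] by blast
    then have "\<one> \<in> M <+>\<^bsub>R\<^esub> PIdl a" by simp
    then obtain m r where m: "m \<in> M" and r: "r \<in> carrier R" and one: "\<one> = m \<oplus> r \<otimes> a"
      unfolding set_add_def' cgenideal_def by blast
    have carr: "m \<in> carrier R" "a \<in> carrier R" using m a Icarr by auto
    have "m \<otimes> m = \<zero>" using ideal_prod.prod[OF m m, of R] sq by simp
    \<comment> \<open>Since \<open>r \<otimes> a\<close> is \<open>\<one> \<ominus> m\<close> and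
      \<open>m\<close> squares to zero, \<open>r \<otimes> (\<one> \<oplus> m)\<close> is an inverse
      of \<open>a\<close>.\<close>
    have "a \<otimes> (r \<otimes> (\<one> \<oplus> m)) = (r \<otimes> a) \<otimes> \<one> \<oplus> (r \<otimes> a) \<otimes> m"
      using carr r by (simp add: m_ac r_distr)
    also have "(r \<otimes> a) \<otimes> m = (m \<oplus> r \<otimes> a) \<otimes> m"
      using carr r \<open>m \<otimes> m = \<zero>\<close> by (simp add: l_distr)
    also have "\<dots> = m" using one[symmetric] carr by simp
    also have "(r \<otimes> a) \<otimes> \<one> \<oplus> m = m \<oplus> r \<otimes> a" using carr r by (simp add: a_comm)
    also note one[symmetric]
    finally have "a \<otimes> (r \<otimes> (\<one> \<oplus> m)) \<in> Units R" by simp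
    then show False using nonunit_mult[OF a, of "r \<otimes> (\<one> \<oplus> m)"] carr r by simp
  qed
qed

theorem proposition4p5:
  fixes R :: "('a, 'b) ring_scheme" and M :: "'a set"
  assumes "cring R"
    and "\<one>\<^bsub>R\<^esub> \<noteq> \<zero>\<^bsub>R\<^esub>"
    and "M = jacobson_radical R"
  shows "((\<forall>I. ideal I R \<and> I \<noteq> carrier R \<longrightarrow> oa_ideal I R) \<longleftrightarrow>
          (\<forall>I. principalideal I R \<and> I \<noteq> carrier R \<longrightarrow> oa_ideal I R)) \<and>
         ((\<forall>I. principalideal I R \<and> I \<noteq> carrier R \<longrightarrow> oa_ideal I R) \<longleftrightarrow>
          (local_ring R \<and> M \<cdot>\<^bsub>R\<^esub> M = {\<zero>\<^bsub>R\<^esub>}))"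
    (is "(?all \<longleftrightarrow> ?principal) \<and> (?principal \<longleftrightarrow> ?local)")
proof -
  interpret cring R by fact
  have "?all \<Longrightarrow> ?principal" by (blast dest: principalideal.axioms(1))
  moreover have ?local if oa: ?principal
  proof
    have max_iff: "maximalideal I R \<longleftrightarrow> I = carrier R - Units R" for I
      using nonunits_add_closed assms(2) oa by (intro maximalideal_iff_nonunits) blast+
    then show "local_ring R"
      by unfold_locales auto
    have M: "M = carrier R - Units R"
      unfolding assms(3) jacobson_radical_def max_iff by auto
    have "s = \<zero>\<^bsub>R\<^esub>" if "s \<in> M \<cdot>\<^bsub>R\<^esub> M" for s
      using that
    proof induction
      case (prod i j)
      then show ?case using nonunits_mult_eq_zero[OF _ assms(2)] oa M by blast
    qed simp
    \<comment> \<open>The inductive rules for the ideal product only yield products and sums; zero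
      is obtained from the product being an ideal.\<close>
    moreover have "\<zero>\<^bsub>R\<^esub> \<in> M \<cdot>\<^bsub>R\<^esub> M"
      using ideal_prod_is_ideal max_iff M
      by (blast intro: additive_subgroup.zero_closed dest: ideal.axioms(1) maximalideal.axioms(1))
    ultimately show "M \<cdot>\<^bsub>R\<^esub> M = {\<zero>\<^bsub>R\<^esub>}" by blast
  qed
  moreover have ?all if ?local
  proof (intro allI impI)
    fix I assume I: "ideal I R \<and> I \<noteq> carrier R"
    have sq: "M \<cdot>\<^bsub>R\<^esub> M = {\<zero>\<^bsub>R\<^esub>}" and max: "maximalideal M R"
      using that local_ring.maximalideal_jacobson_radical assms(3) by auto
    \<comment> \<open>The first alternative of the OA condition holds for all nonunits, because
      their product is zero.\<close>
    have "a \<otimes>\<^bsub>R\<^esub> b \<in> I" if "a \<in> carrier R - Units R" "b \<in> carrier R - Units R" for a b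
    proof -
      have "a \<otimes>\<^bsub>R\<^esub> b \<in> M \<cdot>\<^bsub>R\<^esub> M"
        using that nonunits_subset_maximalideal[OF max sq] by (blast intro: ideal_prod.prod)
      then show ?thesis
        using sq I by (simp add: additive_subgroup.zero_closed ideal.axioms(1))
    qed
    then show "oa_ideal I R"
      using I is_cring by (auto intro!: oa_ideal.intro oa_ideal_axioms.intro)
  qed
  ultimately show ?thesis by blast
qed

end
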